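(* Let $\mathcal A=\{\mathbf a_1,\ldots,\mathbf a_n\}\subset\mathbb R^d$ be a finite point configuration whose convex hull is full-dimensional, let $\Gamma$ be a regular triangulation of the convex hull of $\mathcal A$ with associated height function $\nu:\mathcal A\to\mathbb R$, and let $C=(C_{ij})$ be a real $d\times n$ matrix. For $t>0$ consider the system $$f_{1,t}(X)=\cdots=f_{d,t}(X)=0,\qquad f_{i,t}(X)=\sum_{j=1}^n C_{ij}\,t^{\nu(\mathbf a_j)}X^{\mathbf a_j},\quad i=1,\ldots,d,$$ in the variables $X=(X_1,\dots,X_d)$. Then there exists $t_0>0$ such that for all $0<t<t_0$ the number of non-degenerate solutions of this system contained in the positive orthant is at least the number of $d$-simplices of $\Gamma$ which are positively decorated by $C$.
   Context: For $\mathbf a=(a_1,\dots,a_d)$, $X^{\mathbf a}=X_1^{a_1}\cdots X_d^{a_d}$ (real exponents are allowed since only solutions in the positive orthant $\{x: x_i>0 \text{ for all } i\}$ are considered). A solution is non-degenerate if the Jacobian matrix of $(f_{1,t},\dots,f_{d,t})$ is invertible at it. A triangulation $\Gamma$ of $\operatorname{conv}(\mathcal A)$ with vertices in $\mathcal A$ is regular with associated height function $\nu:\mathcal A\to\mathbb R$ if for every $d$-simplex $\tau$ of $\Gamma$ there is an affine function on $\mathbb R^d$ which coincides with $\nu$ at the vertices of $\tau$ and is strictly smaller than $\nu$ at every other point of $\mathcal A$. A real $d\times(d+1)$ matrix $M$ is oriented if the values $(-1)^i\operatorname{minor}(M,i)$, $i=1,\dots,d+1$, are all nonzero and have the same sign,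 where $\operatorname{minor}(M,i)$ is the determinant of the matrix obtained by removing the $i$-th column of $M$. The matrix $C$ positively decorates a $d$-simplex $\operatorname{conv}(\mathbf a_{i_1},\ldots,\mathbf a_{i_{d+1}})$ of $\Gamma$ if the $d\times(d+1)$ submatrix of $C$ formed by the columns $i_1,\ldots,i_{d+1}$ is oriented. *)

theory Defs
  imports "HOL-Analysis.Analysis"
begin

subsection \<open>Triangulations\<close>

definition vertices :: "'a::euclidean_space set \<Rightarrow> 'a set" where
  "vertices S = {v. v extreme_point_of S}"

text \<open>Not to be confused with the library's unary predicate \<open>triangulation\<close>, which fixes
  neither the union nor the vertices and does not require closure under faces.\<close>

definition triangulation_of_hull ::
    "'a::euclidean_space set \<Rightarrow> 'a set set \<Rightarrow> bool" where
  "triangulation_of_hull A \<Gamma> \<longleftrightarrow>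
     simplicial_complex \<Gamma> \<and> \<Union>\<Gamma> = convex hull A \<and> (\<forall>S\<in>\<Gamma>. vertices S \<subseteq> A)"

text \<open>Only the values of \<open>\<nu>\<close> on \<open>A\<close> matter. The map \<open>\<lambda>x. L x + c\<close> ranges over the affine
  functions.\<close>

definition regular_triangulation_with ::
    "'a::euclidean_space set \<Rightarrow> ('a \<Rightarrow> real) \<Rightarrow> 'a set set \<Rightarrow> bool" where
  "regular_triangulation_with A \<nu> \<Gamma> \<longleftrightarrow>
     triangulation_of_hull A \<Gamma> \<and>
     (\<forall>\<tau>\<in>\<Gamma>. int DIM('a) simplex \<tau> \<longrightarrow>
        (\<exists>L c. linear L \<and>
               (\<forall>v\<in>vertices \<tau>. L v + c = \<nu> v) \<and>
               (\<forall>x\<in>A - vertices \<tau>. L x + c < \<nu> x)))"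

subsection \<open>Oriented matrices\<close>

text \<open>A matrix with \<open>d\<close> rows is given by the list of its columns. The square matrix built from
  \<open>d\<close> columns places them according to the order of the index type \<open>'d\<close> (\<open>card {..<k}\<close> is the
  zero-based position of \<open>k\<close>). Another order on \<open>'d\<close> multiplies all minors by one
  common sign, so that being oriented does not depend on it.\<close>

definition matrix_of_columns :: "(real^'d::{finite,linorder}) list \<Rightarrow> real^'d::{finite,linorder}^'d::{finite,linorder}" where
  "matrix_of_columns cs = (\<chi> r k. (cs ! card {..<k}) $ r)"

text \<open>Columns are numbered from 1.\<close>

definition minor :: "(real^'d::{finite,linorder}) list \<Rightarrow> nat \<Rightarrow> real" where
  "minor cs i = det (matrix_of_columns (take (i - 1) cs @ drop i cs))"

definition oriented :: "(real^'d::{finite,linorder}) list \<Rightarrow> bool" where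
  "oriented cs \<longleftrightarrow>
     length cs = CARD('d) + 1 \<and>
     (\<forall>i\<in>{1..CARD('d) + 1}. (-1) ^ i * minor cs i \<noteq> 0) \<and>
     (\<forall>i\<in>{1..CARD('d) + 1}. \<forall>j\<in>{1..CARD('d) + 1}.
        sgn ((-1) ^ i * minor cs i) = sgn ((-1) ^ j * minor cs j))"

text \<open>The columns of the submatrix are listed in increasing order of their indices.\<close>

definition positively_decorates ::
    "real^'n::{finite,linorder}^'d::{finite,linorder} \<Rightarrow> ('n \<Rightarrow> real^'d::{finite,linorder})
       \<Rightarrow> (real^'d::{finite,linorder}) set \<Rightarrow> bool"
  where
  "positively_decorates C a S \<longleftrightarrow>
     oriented (map (\<lambda>j. column j C) (sorted_list_of_set {j. a j \<in> vertices S}))"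

subsection \<open>The system\<close>

definition monomial :: "real^'d \<Rightarrow> real^'d \<Rightarrow> real" where
  "monomial X e = (\<Prod>k\<in>UNIV. X $ k powr e $ k)"

definition viro_system ::
    "('n::finite \<Rightarrow> real^'d) \<Rightarrow> (real^'d \<Rightarrow> real) \<Rightarrow> real^'n^'d \<Rightarrow> real \<Rightarrow> real^'d \<Rightarrow> real^'d" where
  "viro_system a \<nu> C t X =
     (\<chi> i. \<Sum>j\<in>UNIV. C $ i $ j * t powr \<nu> (a j) * monomial X (a j))"

text \<open>Finiteness of this set is not asserted; lower bounds on its cardinality are to be stated with
  \<open>\<lesssim>\<close>, since \<open>card\<close> is 0 on infinite sets.\<close>

definition nondegenerate_positive_solutions :: "(real^'d \<Rightarrow> real^'d) \<Rightarrow> (real^'d) set" where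
  "nondegenerate_positive_solutions F =
     {X. (\<forall>k. X $ k > 0) \<and> F X = 0 \<and> invertible (jacobian F (at X))}"

end

theory Submission
  imports Defs
begin

text \<open>The simplices are treated one at a time. Let \<open>x \<mapsto> l \<bullet> x + \<gamma>\<close> be the affine function that agrees
  with \<open>\<nu>\<close> at the vertices of a positively decorated simplex and lies below \<open>\<nu>\<close> elsewhere, and put
  \<open>X\<^sub>k = t powr (- l\<^sub>k) * exp y\<^sub>k\<close>. Up to the factor \<open>t powr \<gamma>\<close> the system becomes
  \<open>\<Sum>\<^sub>j t powr h\<^sub>j * exp (y \<bullet> a\<^sub>j) *\<^sub>R c\<^sub>j = 0\<close>, where \<open>c\<^sub>j\<close> are the columns of \<open>C\<close> and \<open>h\<^sub>j \<ge> 0\<close> vanishes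
  exactly at the vertices of the simplex (\<open>viro_system_log_coordinates\<close>). As \<open>t\<close> tends to 0 the other
  terms disappear.

  The limiting system has a nondegenerate zero: the \<open>d \<times> (d + 1)\<close> matrix of the columns at the
  vertices is oriented, so its kernel is spanned by a positive vector (\<open>oriented_map_kernel\<close>), and since the
  vertices are affinely independent, \<open>y\<close> can be chosen so that the numbers \<open>exp (y \<bullet> a\<^sub>j)\<close> are
  proportional to that vector (\<open>zeros_near_face_system\<close>). A contraction argument shows that this zero
  persists, at bounded distance and with invertible derivative, for small \<open>t\<close>
  (\<open>nondegenerate_zero_persists\<close>).

  Finally, different simplices have different gradients \<open>l\<close>
  (\<open>lower_face_determined_by_gradient\<close>), and the logarithm of the solution that comes from a simplex is
  \<open>- ln t *\<^sub>R l\<close> up to a bounded error. Hence the finitely many solutions move apart in logarithmic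
  coordinates as \<open>t\<close> tends to 0, and for small \<open>t\<close> they are distinct.\<close>

section \<open>Kernels of oriented matrices\<close>

definition position :: "'d::{finite,linorder} \<Rightarrow> nat" where
  "position k = card {..<k}"

lemma bij_betw_position: "bij_betw (position :: 'd::{finite,linorder} \<Rightarrow> nat) UNIV {..<CARD('d)}"
proof -
  have mono: "position x < position y" if "x < y" for x y :: 'd
    unfolding position_def using that by (intro psubset_card_mono) auto
  have inj: "inj (position :: 'd \<Rightarrow> nat)"
    by (rule injI) (metis mono less_irrefl linorder_cases)
  have sub: "range (position :: 'd \<Rightarrow> nat) \<subseteq> {..<CARD('d)}"
    unfolding position_def by (auto intro!: psubset_card_mono)
  have "range (position :: 'd \<Rightarrow> nat) = {..<CARD('d)}"
    using inj sub by (intro card_subset_eq) (auto simp: card_image)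
  with inj show ?thesis
    by (simp add: bij_betw_def)
qed

text \<open>Deleting entry \<open>p\<close> of a list moves the entry at \<open>skip p i\<close> to place \<open>i\<close>.\<close>

definition skip :: "nat \<Rightarrow> nat \<Rightarrow> nat" where
  "skip p i = (if i < p then i else Suc i)"

lemma bij_betw_skip:
  assumes "p \<le> n"
  shows "bij_betw (skip p) {..<n} ({..n} - {p})"
proof (rule bij_betw_imageI)
  show "inj_on (skip p) {..<n}"
    by (auto simp: inj_on_def skip_def split: if_splits)
  show "skip p ` {..<n} = {..n} - {p}"
  proof (intro equalityI subsetI)
    fix i assume "i \<in> {..n} - {p}"
    then show "i \<in> skip p ` {..<n}"
      using assms by (intro image_eqI[of _ _ "if i < p then i else i - 1"]) (auto simp: skip_def)
  qed (use assms in \<open>auto simp: skip_def\<close>)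
qed

lemma matrix_of_columns_remove_nth:
  fixes cs :: "(real^'d::{finite,linorder}) list"
  assumes "length cs = CARD('d) + 1" "p \<le> CARD('d)"
  shows "matrix_of_columns (take p cs @ drop (Suc p) cs) $ r $ k = cs ! skip p (position k) $ r"
proof -
  have "position k < CARD('d)"
    using bij_betw_position[where 'd='d] by (auto simp: bij_betw_def)
  then show ?thesis
    using assms by (simp add: matrix_of_columns_def skip_def nth_append flip: position_def)
qed

lemma remove_nth_mult_eq_sum:
  fixes cs :: "(real^'d::{finite,linorder}) list"
  assumes "length cs = CARD('d) + 1" "p \<le> CARD('d)"
  shows "matrix_of_columns (take p cs @ drop (Suc p) cs) *v (\<chi> k. w (skip p (position k)))
           = (\<Sum>i\<in>{..CARD('d)} - {p}. w i *\<^sub>R cs ! i)"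
proof -
  have bij: "bij_betw (\<lambda>k::'d. skip p (position k)) UNIV ({..CARD('d)} - {p})"
    using bij_betw_trans[OF bij_betw_position bij_betw_skip[OF assms(2)]] by (simp add: o_def)
  have "matrix_of_columns (take p cs @ drop (Suc p) cs) *v (\<chi> k. w (skip p (position k)))
          = (\<Sum>k\<in>UNIV. w (skip p (position k)) *\<^sub>R cs ! skip p (position (k::'d)))"
    by (simp add: vec_eq_iff matrix_vector_mult_def matrix_of_columns_remove_nth[OF assms] mult.commute)
  also have "\<dots> = (\<Sum>i\<in>{..CARD('d)} - {p}. w i *\<^sub>R cs ! i)"
    by (rule sum.reindex_bij_betw[OF bij])
  finally show ?thesis .
qed

text \<open>The matrices whose determinants are the minors omitting \<open>c\<^sub>p\<close> and \<open>c\<^sub>p\<^sub>+\<^sub>1\<close> differ in a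
  single column, which is \<open>c\<^sub>p\<^sub>+\<^sub>1\<close> in the first and \<open>c\<^sub>p\<close> in the second. A linear relation between
  all columns expresses \<open>- w\<^sub>p c\<^sub>p\<close> through the columns of the first matrix, so Cramer's rule compares
  the two determinants; the two columns occupy the same place, so no sign of a permutation arises.\<close>

lemma adjacent_minors:
  fixes cs :: "(real^'d::{finite,linorder}) list"
  assumes len: "length cs = CARD('d) + 1" and p: "p < CARD('d)"
    and rel: "(\<Sum>i\<le>CARD('d). w i *\<^sub>R cs ! i) = 0"
  shows "w (Suc p) * minor cs (Suc p) = - w p * minor cs (Suc (Suc p))"
proof -
  define A where "A = matrix_of_columns (take p cs @ drop (Suc p) cs)"
  define B where "B = matrix_of_columns (take (Suc p) cs @ drop (Suc (Suc p)) cs)"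
  define x where "x = (\<chi> k::'d. w (skip p (position k)))"
  obtain k :: 'd where k: "position k = p"
    using bij_betw_position[where 'd='d] p by (metis bij_betw_iff_bijections lessThan_iff)
  have "A *v x = (\<Sum>i\<in>{..CARD('d)} - {p}. w i *\<^sub>R cs ! i)"
    unfolding A_def x_def using len p by (intro remove_nth_mult_eq_sum) auto
  also have "\<dots> = - w p *\<^sub>R cs ! p"
    using rel p sum.remove[of "{..CARD('d)}" p "\<lambda>i. w i *\<^sub>R cs ! i"]
    by (simp add: eq_neg_iff_add_eq_0 add.commute)
  finally have Ax: "A *v x = - w p *\<^sub>R cs ! p" .
  \<comment> \<open>The two matrices agree outside column \<open>k\<close>: \<open>skip p\<close> and \<open>skip (Suc p)\<close> differ only at \<open>p\<close>.\<close>
  have same: "A $ i $ j = B $ i $ j" if "j \<noteq> k" for i j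
  proof -
    have "position j \<noteq> p"
      using that k bij_betw_position[where 'd='d] by (metis bij_betw_def injD)
    then have "skip p (position j) = skip (Suc p) (position j)"
      by (auto simp: skip_def)
    then show ?thesis
      using len p by (simp add: A_def B_def matrix_of_columns_remove_nth)
  qed
  have col: "B $ i $ k = cs ! p $ i" for i
    using len p k by (simp add: B_def matrix_of_columns_remove_nth skip_def)
  have "w (Suc p) * det A = x $ k * det A"
    by (simp add: x_def k skip_def)
  also have "\<dots> = det (\<chi> i j. if j = k then (A *v x) $ i else A $ i $ j)"
    by (rule cramer_lemma[symmetric])
  also have "\<dots> = det (transpose (\<chi> j. if j = k then (- w p) *s transpose B $ j else transpose B $ j))"
    by (rule arg_cong[of _ _ det]) (auto simp: vec_eq_iff transpose_def Ax same col)
  also have "\<dots> = - w p * det (\<chi> j. if j = k then transpose B $ j else transpose B $ j)"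
    by (simp add: det_row_mul)
  also have "(\<chi> j. if j = k then transpose B $ j else transpose B $ j) = transpose B"
    by (simp add: vec_eq_iff)
  finally show ?thesis
    by (simp add: A_def B_def minor_def)
qed

text \<open>By the comparison of adjacent minors, every kernel vector is proportional to the vector \<open>m\<close> of
  signed minors. A nonzero kernel vector exists because the columns after the first one form a basis,
  hence \<open>m\<close> spans the kernel, and being oriented says exactly that \<open>m\<close> or \<open>- m\<close> is positive;
  \<open>l\<close> is the positive one.\<close>

lemma oriented_kernel:
  fixes cs :: "(real^'d::{finite,linorder}) list"
  assumes "oriented cs"
  obtains l where "\<And>i. i \<le> CARD('d) \<Longrightarrow> l i > (0::real)"
    and "(\<Sum>i\<le>CARD('d). l i *\<^sub>R cs ! i) = 0"
    and "\<And>w. (\<Sum>i\<le>CARD('d). w i *\<^sub>R cs ! i) = 0 \<Longrightarrow> \<exists>\<kappa>. \<forall>i\<le>CARD('d). w i = \<kappa> * l i"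
proof -
  define m where "m i = (-1) ^ Suc i * minor cs (Suc i)" for i
  define l where "l i = \<bar>m i\<bar>" for i
  have len: "length cs = CARD('d) + 1"
    and m_nz: "\<And>i. i \<le> CARD('d) \<Longrightarrow> m i \<noteq> 0"
    and m_sgn: "\<And>i. i \<le> CARD('d) \<Longrightarrow> sgn (m i) = sgn (m 0)"
  proof -
    show "length cs = CARD('d) + 1"
      using assms by (simp add: oriented_def)
    show "m i \<noteq> 0" if "i \<le> CARD('d)" for i
      using assms that by (auto simp: oriented_def m_def)
    show "sgn (m i) = sgn (m 0)" if "i \<le> CARD('d)" for i
    proof -
      have "Suc i \<in> {1..CARD('d) + 1}" "Suc 0 \<in> {1..CARD('d) + 1}"
        using that by auto
      then show ?thesis
        using assms unfolding oriented_def m_def by blast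
    qed
  qed
  have l_eq: "l i = sgn (m 0) * m i" if "i \<le> CARD('d)" for i
    using m_sgn[OF that] by (metis l_def abs_sgn mult.commute)
  have l_pos: "l i > 0" if "i \<le> CARD('d)" for i
    using m_nz[OF that] by (simp add: l_def)
  have multiple: "\<exists>\<kappa>. \<forall>i\<le>CARD('d). w i = \<kappa> * l i"
    if rel: "(\<Sum>i\<le>CARD('d). w i *\<^sub>R cs ! i) = 0" for w
  proof -
    have step: "w (Suc p) * m p = w p * m (Suc p)" if "p < CARD('d)" for p
    proof -
      have "w (Suc p) * m p = (-1) ^ Suc p * (w (Suc p) * minor cs (Suc p))"
        by (simp add: m_def)
      also have "\<dots> = w p * m (Suc p)"
        by (simp add: adjacent_minors[OF len that rel] m_def)
      finally show ?thesis .
    qed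
    have "w i = w 0 / m 0 * m i" if "i \<le> CARD('d)" for i
      using that
    proof (induction i)
      case 0
      then show ?case using m_nz by simp
    next
      case (Suc i)
      then have "w (Suc i) * m i = w 0 / m 0 * m (Suc i) * m i"
        using step[of i] by simp
      then show ?case
        by (metis Suc.prems Suc_leD m_nz mult_right_cancel)
    qed
    moreover have "m i = sgn (m 0) * l i" if "i \<le> CARD('d)" for i
      using m_nz[of 0] by (simp add: l_eq[OF that] flip: mult.assoc)
    ultimately have "\<forall>i\<le>CARD('d). w i = (w 0 / m 0 * sgn (m 0)) * l i"
      by (metis mult.assoc)
    then show ?thesis by blast
  qed
  \<comment> \<open>Write the first column in terms of the others.\<close>
  obtain w where w0: "w 0 = (-1::real)" and w: "(\<Sum>i\<le>CARD('d). w i *\<^sub>R cs ! i) = 0"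
  proof -
    define A where "A = matrix_of_columns (take 0 cs @ drop (Suc 0) cs)"
    have "det A \<noteq> 0"
      using m_nz[of 0] by (simp add: m_def minor_def A_def)
    then obtain x where x: "A *v x = cs ! 0"
      using cramer[of A _ "cs ! 0"] by blast
    define w where "w i = (if i = 0 then -1 else x $ (inv_into UNIV position (i - 1)))" for i
    have "inj (position :: 'd \<Rightarrow> nat)"
      using bij_betw_position[where 'd='d] by (simp add: bij_betw_def)
    then have xw: "x = (\<chi> k. w (skip 0 (position k)))"
      by (simp add: vec_eq_iff w_def skip_def)
    have "(\<Sum>i\<in>{..CARD('d)} - {0}. w i *\<^sub>R cs ! i) = cs ! 0"
      using remove_nth_mult_eq_sum[OF len, of 0 w] x unfolding A_def xw by simp
    then have "(\<Sum>i\<le>CARD('d). w i *\<^sub>R cs ! i) = 0"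
      by (simp add: sum.remove[of "{..CARD('d)}" 0] w_def)
    then show ?thesis
      using that[of w] by (simp add: w_def)
  qed
  obtain \<kappa> where \<kappa>: "\<And>i. i \<le> CARD('d) \<Longrightarrow> w i = \<kappa> * l i"
    using multiple[OF w] by blast
  have "\<kappa> \<noteq> 0"
    using \<kappa>[of 0] w0 by auto
  moreover have "\<kappa> *\<^sub>R (\<Sum>i\<le>CARD('d). l i *\<^sub>R cs ! i) = 0"
    using w \<kappa> by (simp add: scaleR_sum_right)
  ultimately have "(\<Sum>i\<le>CARD('d). l i *\<^sub>R cs ! i) = 0"
    by simp
  with l_pos show ?thesis
    using multiple by (rule that)
qed

lemma oriented_map_kernel:
  fixes f :: "'n \<Rightarrow> real^'d::{finite,linorder}"
  assumes or: "oriented (map f js)" and dist: "distinct js"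
  obtains l where "\<And>j. j \<in> set js \<Longrightarrow> l j > (0::real)"
    and "(\<Sum>j\<in>set js. l j *\<^sub>R f j) = 0"
    and "\<And>w. (\<Sum>j\<in>set js. w j *\<^sub>R f j) = 0 \<Longrightarrow> \<exists>\<kappa>. \<forall>j\<in>set js. w j = \<kappa> * l j"
proof -
  have len: "length js = Suc CARD('d)"
    using or by (simp add: oriented_def)
  have bij: "bij_betw ((!) js) {..CARD('d)} (set js)"
    using dist len by (intro bij_betw_nth) auto
  have sum_eq: "(\<Sum>j\<in>set js. w j *\<^sub>R f j) = (\<Sum>i\<le>CARD('d). w (js ! i) *\<^sub>R map f js ! i)" for w
    using len by (simp flip: sum.reindex_bij_betw[OF bij])
  obtain \<mu> where \<mu>: "\<And>i. i \<le> CARD('d) \<Longrightarrow> \<mu> i > (0::real)"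
      "(\<Sum>i\<le>CARD('d). \<mu> i *\<^sub>R map f js ! i) = 0"
      "\<And>w. (\<Sum>i\<le>CARD('d). w i *\<^sub>R map f js ! i) = 0 \<Longrightarrow> \<exists>\<kappa>. \<forall>i\<le>CARD('d). w i = \<kappa> * \<mu> i"
    using oriented_kernel[OF or] by blast
  define l where "l j = \<mu> (inv_into {..CARD('d)} ((!) js) j)" for j
  have l: "l (js ! i) = \<mu> i" if "i \<le> CARD('d)" for i
    using bij that by (simp add: l_def bij_betw_inv_into_left)
  have set_js: "set js = (!) js ` {..CARD('d)}"
    using bij by (simp add: bij_betw_def)
  show ?thesis
  proof (rule that)
    show "l j > 0" if "j \<in> set js" for j
      using that \<mu>(1) l by (auto simp: set_js)
    show "(\<Sum>j\<in>set js. l j *\<^sub>R f j) = 0"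
      using \<mu>(2) by (simp only: sum_eq) (simp add: l)
    show "\<exists>\<kappa>. \<forall>j\<in>set js. w j = \<kappa> * l j" if "(\<Sum>j\<in>set js. w j *\<^sub>R f j) = 0" for w
      using \<mu>(3)[of "\<lambda>i. w (js ! i)"] that unfolding sum_eq
      by (auto simp: set_js l)
  qed
qed

section \<open>Affine functions on an affine basis\<close>

lemma affine_independent_interpolation:
  fixes V :: "'a::euclidean_space set" and u :: "'a \<Rightarrow> real"
  assumes "\<not> affine_dependent V"
  obtains y b where "\<And>v. v \<in> V \<Longrightarrow> v \<bullet> y + b = u v"
proof (cases "V = {}")
  case True
  then show ?thesis using that by auto
next
  case False
  then obtain o' where o': "o' \<in> V" by auto
  have ind: "independent ((\<lambda>x. - o' + x) ` (V - {o'}))"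
    using assms affine_dependent_iff_dependent2[OF o'] by simp
  obtain f :: "'a \<Rightarrow> real" where f: "linear f"
    and f_eq: "\<And>x. x \<in> (\<lambda>x. - o' + x) ` (V - {o'}) \<Longrightarrow> f x = u (o' + x) - u o'"
    using linear_independent_extend[OF ind, of "\<lambda>x. u (o' + x) - u o'"] by blast
  have inner: "v \<bullet> adjoint f 1 = f v" for v
    using adjoint_works[OF f, of v 1] by simp
  show ?thesis
  proof (rule that)
    fix v assume v: "v \<in> V"
    have "f v - f o' = u v - u o'"
    proof (cases "v = o'")
      case False
      then have "f (- o' + v) = u (o' + (- o' + v)) - u o'"
        using v by (intro f_eq) auto
      then show ?thesis
        using linear_diff[OF f, of v o'] by simp
    qed simp
    then show "v \<bullet> adjoint f 1 + (u o' - f o') = u v"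
      by (simp add: inner)
  qed
qed

lemma constant_on_affine_basis:
  fixes V :: "'a::euclidean_space set"
  assumes "\<not> affine_dependent V" "card V = Suc DIM('a)"
    and const: "\<And>v. v \<in> V \<Longrightarrow> h \<bullet> v = \<kappa>"
  shows "h = 0"
proof -
  have "affine hull V \<subseteq> {x. h \<bullet> x = \<kappa>}"
    using const by (intro hull_minimal) (auto simp: affine_hyperplane)
  then have "h \<bullet> x = \<kappa>" for x
    using affine_independent_span_eq[OF assms(1,2)] by auto
  from this[of 0] this[of h] show ?thesis
    by simp
qed

section \<open>Persistence of nondegenerate zeros\<close>

text \<open>A version of the implicit function theorem in which the parameter runs along a filter. With \<open>B\<close>
  the inverse of the limiting derivative \<open>A\<close>, the Newton-type map \<open>y \<mapsto> y - B (G s y)\<close> has derivative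
  close to \<open>id - B A = 0\<close>. It is therefore a contraction with factor \<open>1/2\<close> of a small ball around
  \<open>y0\<close>, and it moves the centre by at most half the radius; its fixed point is the zero. The same
  estimate \<open>\<parallel>id - B D\<parallel> \<le> 1/2\<close> makes the derivative injective there.\<close>

lemma nondegenerate_zero_persists:
  fixes G :: "'s \<Rightarrow> 'a::euclidean_space \<Rightarrow> 'a" and D :: "'s \<Rightarrow> 'a \<Rightarrow> 'a \<Rightarrow>\<^sub>L 'a"
  assumes deriv: "\<And>s y. (G s has_derivative D s y) (at y)"
    and value_lim: "((\<lambda>s. G s y0) \<longlongrightarrow> 0) F"
    and deriv_lim: "((\<lambda>(s, y). D s y) \<longlongrightarrow> A) (F \<times>\<^sub>F nhds y0)"
    and inj: "inj A" and r: "r > 0"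
  shows "\<forall>\<^sub>F s in F. \<exists>y\<in>cball y0 r. G s y = 0 \<and> inj (D s y)"
proof -
  obtain g where g: "linear g" "g \<circ> blinfun_apply A = id"
    using linear_injective_left_inverse[OF _ inj] by (auto simp: bounded_linear.linear blinfun.bounded_linear_right)
  define B where "B = Blinfun g"
  have B: "blinfun_apply B = g"
    using g by (simp add: B_def bounded_linear_Blinfun_apply linear_conv_bounded_linear)
  have BA: "B o\<^sub>L A = id_blinfun"
    using g by (intro blinfun_eqI) (simp add: B fun_eq_iff)
  have inj_B: "inj g"
  proof (rule inj_on_inverseI)
    have "blinfun_apply A \<circ> g = id"
      using linear_inverse_left[of "blinfun_apply A" g] g
      by (simp add: bounded_linear.linear blinfun.bounded_linear_right)
    then show "blinfun_apply A (g x) = x" for x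
      by (simp add: fun_eq_iff)
  qed
  have "((\<lambda>(s, y). id_blinfun - (B o\<^sub>L D s y)) \<longlongrightarrow> id_blinfun - (B o\<^sub>L A)) (F \<times>\<^sub>F nhds y0)"
    using deriv_lim unfolding case_prod_unfold by (intro tendsto_intros)
  then have "\<forall>\<^sub>F (s, y) in F \<times>\<^sub>F nhds y0. norm (id_blinfun - (B o\<^sub>L D s y)) < 1/2"
    unfolding BA by (auto simp: tendsto_iff dist_norm case_prod_unfold dest: spec[of _ "1/2"])
  then obtain P Q where P: "eventually P F" and Q: "eventually Q (nhds y0)"
    and PQ: "\<And>s y. P s \<Longrightarrow> Q y \<Longrightarrow> norm (id_blinfun - (B o\<^sub>L D s y)) < 1/2"
    unfolding eventually_prod_filter by auto
  obtain e where e: "e > 0" and Qe: "\<And>y. dist y y0 < e \<Longrightarrow> Q y"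
    using Q unfolding eventually_nhds_metric by auto
  define \<delta> where "\<delta> = min r (e/2)"
  have \<delta>: "\<delta> > 0" "\<delta> \<le> r" "\<delta> < e"
    using r e by (auto simp: \<delta>_def)
  have "((\<lambda>s. B (G s y0)) \<longlongrightarrow> B 0) F"
    using value_lim by (intro tendsto_intros)
  then have "\<forall>\<^sub>F s in F. norm (B (G s y0)) < \<delta>/2"
    using \<delta>(1) by (auto simp: tendsto_iff dist_norm dest: spec[of _ "\<delta>/2"])
  with P show ?thesis
  proof eventually_elim
    case (elim s)
    define T where "T y = y - B (G s y)" for y
    have near: "norm (id_blinfun - (B o\<^sub>L D s y)) \<le> 1/2" if "y \<in> cball y0 \<delta>" for y
      using PQ[OF elim(1) Qe[of y]] that \<delta>(3) by (auto simp: dist_commute)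
    have T_deriv: "(T has_derivative (id_blinfun - (B o\<^sub>L D s y))) (at y within cball y0 \<delta>)" for y
    proof -
      have "((\<lambda>y. B (G s y)) has_derivative (\<lambda>h. B (D s y h))) (at y within cball y0 \<delta>)"
        by (rule bounded_linear.has_derivative[OF blinfun.bounded_linear_right
              has_derivative_at_withinI[OF deriv]])
      then show ?thesis
        using has_derivative_diff[OF has_derivative_ident]
        by (simp add: T_def[abs_def] blinfun.diff_left[abs_def])
    qed
    have contr: "dist (T x) (T y) \<le> 1/2 * dist x y" if "x \<in> cball y0 \<delta>" "y \<in> cball y0 \<delta>" for x y
      using differentiable_bound[of "cball y0 \<delta>" T "\<lambda>y. id_blinfun - (B o\<^sub>L D s y)" "1/2" x y]
        T_deriv near that by (simp add: dist_norm norm_blinfun.rep_eq)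
    have "T y \<in> cball y0 \<delta>" if y: "y \<in> cball y0 \<delta>" for y
    proof -
      have "dist y0 (T y) \<le> dist y0 (T y0) + dist (T y0) (T y)"
        by (rule dist_triangle)
      moreover have "dist y0 (T y0) \<le> \<delta>/2"
        using elim(2) by (simp add: T_def dist_norm)
      moreover have "dist (T y0) (T y) \<le> 1/2 * dist y0 y"
        using contr y \<delta>(1) by simp
      ultimately show ?thesis
        using y by simp
    qed
    then have "T ` cball y0 \<delta> \<subseteq> cball y0 \<delta>"
      by blast
    then obtain y where y: "y \<in> cball y0 \<delta>" "T y = y"
      using Banach_fix[of "cball y0 \<delta>" "1/2" T] contr \<delta>(1)
      by (auto simp: complete_eq_closed)
    have "G s y = 0"
      using y(2) inj_B g(1) by (auto simp: T_def B linear_injective_0)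
    moreover have "inj (D s y)"
    proof -
      have "h = 0" if "D s y h = 0" for h
      proof -
        have "norm h = norm ((id_blinfun - (B o\<^sub>L D s y)) h)"
          using that by (simp add: blinfun.diff_left)
        also have "\<dots> \<le> 1/2 * norm h"
          using norm_blinfun near[OF y(1)] by (meson mult_right_mono norm_ge_zero order_trans)
        finally show ?thesis by simp
      qed
      then show ?thesis
        by (simp add: linear_injective_0 blinfun.bounded_linear_right bounded_linear.linear)
    qed
    ultimately show ?case
      using y(1) \<delta>(2) by auto
  qed
qed

section \<open>Zeros near the system of one simplex\<close>

lemma exponential_sum_has_derivative:
  fixes a :: "'n::finite \<Rightarrow> 'a::real_inner" and c :: "'n \<Rightarrow> 'b::real_normed_vector"
  shows "((\<lambda>y. \<Sum>j\<in>UNIV. (s j * exp (y \<bullet> a j)) *\<^sub>R c j) has_derivative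
          (\<lambda>v. \<Sum>j\<in>UNIV. (s j * exp (y \<bullet> a j) * (v \<bullet> a j)) *\<^sub>R c j)) (at y)"
  by (auto intro!: derivative_eq_intros sum.cong simp: algebra_simps)

lemma tendsto_powr_at_right_0:
  assumes "h \<ge> (0::real)"
  shows "((\<lambda>t. t powr h) \<longlongrightarrow> (if h = 0 then 1 else 0)) (at_right 0)"
proof (cases "h = 0")
  case True
  have "\<forall>\<^sub>F t in at_right 0. t powr h = (1::real)"
    unfolding eventually_at_right_field by (intro exI[of _ 1]) (auto simp: True)
  then show ?thesis
    using True by (simp add: tendsto_eventually)
next
  case False
  then have "((\<lambda>t. t powr h) \<longlongrightarrow> 0 powr h) (at_right 0)"
    using assms by (intro tendsto_powr2) (auto simp: eventually_at_right_less intro: eventually_mono[OF eventually_at_right_less])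
  then show ?thesis
    using False by simp
qed

text \<open>As \<open>t\<close> tends to 0 only the terms with \<open>h j = 0\<close> survive, and these have affinely independent
  exponents. The exponentials \<open>exp (y \<bullet> a j)\<close> can then be given any prescribed positive values up to a
  common factor, so they can be matched with the positive kernel vector \<open>l\<close>; this yields the zero \<open>y0\<close> of
  the limit. If the derivative of the limit kills \<open>v\<close>, then \<open>exp (y0 \<bullet> a j) * (v \<bullet> a j)\<close> is again a kernel
  vector, hence a multiple of \<open>l\<close>, so that \<open>v \<bullet> a j\<close> does not depend on \<open>j\<close>; as the exponents affinely
  span the space, \<open>v = 0\<close>. The nondegenerate zero \<open>y0\<close> persists for small \<open>t\<close>.\<close>

lemma zeros_near_face_system:
  fixes a c :: "'n::finite \<Rightarrow> 'a::euclidean_space" and h :: "'n \<Rightarrow> real"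
  defines "I \<equiv> {j. h j = 0}"
  assumes h: "\<And>j. h j \<ge> 0"
    and indep: "\<not> affine_dependent (a ` I)" and card: "card (a ` I) = Suc DIM('a)"
    and inj_a: "inj_on a I"
    and l_pos: "\<And>j. j \<in> I \<Longrightarrow> l j > 0"
    and l_rel: "(\<Sum>j\<in>I. l j *\<^sub>R c j) = 0"
    and l_ker: "\<And>w. (\<Sum>j\<in>I. w j *\<^sub>R c j) = 0 \<Longrightarrow> \<exists>\<kappa>. \<forall>j\<in>I. w j = \<kappa> * l j"
  obtains y0 where "\<forall>\<^sub>F t in at_right 0. \<exists>y\<in>cball y0 1.
      (\<Sum>j\<in>UNIV. (t powr h j * exp (y \<bullet> a j)) *\<^sub>R c j) = 0 \<and>
      inj (\<lambda>v. \<Sum>j\<in>UNIV. (t powr h j * exp (y \<bullet> a j) * (v \<bullet> a j)) *\<^sub>R c j)"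
proof -
  define E where "E j = blinfun_scaleR_left (c j) o\<^sub>L blinfun_inner_left (a j)" for j
  define G where "G t y = (\<Sum>j\<in>UNIV. (t powr h j * exp (y \<bullet> a j)) *\<^sub>R c j)" for t y
  define D where "D t y = (\<Sum>j\<in>UNIV. (t powr h j * exp (y \<bullet> a j)) *\<^sub>R E j)" for t y
  have E: "blinfun_apply (E j) v = (v \<bullet> a j) *\<^sub>R c j" for j v
    by (simp add: E_def)
  have D: "blinfun_apply (D t y) = (\<lambda>v. \<Sum>j\<in>UNIV. (t powr h j * exp (y \<bullet> a j) * (v \<bullet> a j)) *\<^sub>R c j)" for t y
    by (simp add: fun_eq_iff D_def E blinfun.sum_left blinfun.scaleR_left)
  obtain y0 b where y0: "\<And>v. v \<in> a ` I \<Longrightarrow> v \<bullet> y0 + b = ln (l (inv_into I a v))"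
    using affine_independent_interpolation[OF indep, where u = "\<lambda>v. ln (l (inv_into I a v))"] by blast
  have exp_y0: "exp (y0 \<bullet> a j) = exp (- b) * l j" if "j \<in> I" for j
  proof -
    have "y0 \<bullet> a j = ln (l j) - b"
      using y0[of "a j"] that inj_a by (simp add: inner_commute inv_into_f_f)
    then show ?thesis
      using l_pos[OF that] by (simp add: exp_diff exp_minus divide_inverse)
  qed
  let ?s = "\<lambda>j. if h j = 0 then 1 else 0 :: real"
  have restrict: "(\<Sum>j\<in>UNIV. (?s j * f j) *\<^sub>R x j) = (\<Sum>j\<in>I. f j *\<^sub>R (x j :: 'v::real_vector))" for f x
    unfolding I_def by (rule sum.mono_neutral_cong_right) auto
  define A where "A = (\<Sum>j\<in>UNIV. (?s j * exp (y0 \<bullet> a j)) *\<^sub>R E j)"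
  have A: "A v = (\<Sum>j\<in>I. (exp (y0 \<bullet> a j) * (v \<bullet> a j)) *\<^sub>R c j)" for v
    by (simp add: A_def restrict blinfun.sum_left blinfun.scaleR_left E)
  have inj_A: "inj A"
  proof -
    have "v = 0" if v: "A v = 0" for v
    proof -
      obtain \<kappa> where \<kappa>: "\<forall>j\<in>I. exp (y0 \<bullet> a j) * (v \<bullet> a j) = \<kappa> * l j"
        using l_ker[OF v[unfolded A]] by blast
      have "v \<bullet> a j = \<kappa> * exp b" if "j \<in> I" for j
        using \<kappa>[rule_format, OF that] l_pos[OF that]
        by (simp add: exp_y0[OF that] exp_minus field_simps)
      then show ?thesis
        by (intro constant_on_affine_basis[OF indep card]) auto
    qed
    then show ?thesis
      by (simp add: linear_injective_0 blinfun.bounded_linear_right bounded_linear.linear)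
  qed
  have "\<forall>\<^sub>F t in at_right 0. \<exists>y\<in>cball y0 1. G t y = 0 \<and> inj (D t y)"
  proof (rule nondegenerate_zero_persists)
    show "(G t has_derivative D t y) (at y)" for t y
      unfolding G_def D by (rule exponential_sum_has_derivative)
    have "((\<lambda>t. G t y0) \<longlongrightarrow> (\<Sum>j\<in>UNIV. (?s j * exp (y0 \<bullet> a j)) *\<^sub>R c j)) (at_right 0)"
      unfolding G_def by (intro tendsto_intros tendsto_powr_at_right_0 h)
    also have "(\<Sum>j\<in>UNIV. (?s j * exp (y0 \<bullet> a j)) *\<^sub>R c j) = exp (- b) *\<^sub>R (\<Sum>j\<in>I. l j *\<^sub>R c j)"
      by (simp add: restrict scaleR_sum_right exp_y0)
    finally show "((\<lambda>t. G t y0) \<longlongrightarrow> 0) (at_right 0)"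
      by (simp add: l_rel)
    have "((\<lambda>p. fst p powr h j) \<longlongrightarrow> ?s j) (at_right 0 \<times>\<^sub>F nhds y0)" for j
      by (rule filterlim_compose[OF tendsto_powr_at_right_0[OF h] filterlim_fst])
    moreover have "((\<lambda>p. snd p) \<longlongrightarrow> y0) (at_right (0::real) \<times>\<^sub>F nhds y0)"
      by (rule filterlim_snd)
    ultimately show "((\<lambda>(t, y). D t y) \<longlongrightarrow> A) (at_right 0 \<times>\<^sub>F nhds y0)"
      unfolding D_def A_def case_prod_unfold by (intro tendsto_intros)
    show "inj A" by (rule inj_A)
  qed simp
  then show ?thesis
    by (intro that[of y0]) (simp add: G_def D)
qed

section \<open>Logarithmic coordinates\<close>

lemma monomial_eq_exp:
  assumes "\<And>k. X $ k > 0"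
  shows "monomial X e = exp ((\<chi> k. ln (X $ k)) \<bullet> e)"
  using assms by (simp add: monomial_def inner_vec_def exp_sum powr_def less_imp_neq[THEN not_sym] mult.commute)

text \<open>Translating the logarithmic coordinates by \<open>ln t *\<^sub>R l\<close> subtracts the affine function
  \<open>x \<mapsto> l \<bullet> x + \<gamma>\<close> from the heights, up to the common factor \<open>t powr \<gamma>\<close>.\<close>

lemma viro_system_log_coordinates:
  assumes X: "\<And>k. X $ k > 0" and t: "t > 0"
  shows "viro_system a \<nu> C t X = (t powr \<gamma>) *\<^sub>R
    (\<Sum>j\<in>UNIV. (t powr (\<nu> (a j) - (l \<bullet> a j + \<gamma>)) * exp (((\<chi> k. ln (X $ k)) + ln t *\<^sub>R l) \<bullet> a j))
       *\<^sub>R column j C)"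
proof -
  have "t powr \<nu> (a j) * monomial X (a j) = t powr \<gamma> *
     (t powr (\<nu> (a j) - (l \<bullet> a j + \<gamma>)) * exp (((\<chi> k. ln (X $ k)) + ln t *\<^sub>R l) \<bullet> a j))" for j
    using t by (simp add: monomial_eq_exp[OF X] powr_def inner_add_left algebra_simps flip: exp_add)
  then show ?thesis
    by (simp add: viro_system_def vec_eq_iff column_def sum_distrib_left mult.assoc)
      (simp add: mult_ac)
qed

text \<open>Nondegeneracy is transported because the logarithm is a diffeomorphism of the positive orthant:
  its derivative divides the coordinates of a vector by those of \<open>X\<close>.\<close>

lemma nondegenerate_zero_log_coordinates:
  fixes F G :: "real^'d \<Rightarrow> real^'d"
  assumes FG: "\<And>X. (\<And>k. X $ k > 0) \<Longrightarrow> F X = K *\<^sub>R G ((\<chi> k. ln (X $ k)) + b)"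
    and K: "K \<noteq> 0" and deriv: "(G has_derivative D) (at y)" and zero: "G y = 0" and inj: "inj D"
  shows "(\<chi> k. exp (y $ k - b $ k)) \<in> nondegenerate_positive_solutions F"
proof -
  define X :: "real^'d" where "X = (\<chi> k. exp (y $ k - b $ k))"
  have pos: "X $ k > 0" for k
    by (simp add: X_def)
  have y: "(\<chi> k. ln (X $ k)) + b = y"
    by (simp add: X_def vec_eq_iff)
  have open_orthant: "open {Z::real^'d. \<forall>k. Z $ k > 0}"
  proof -
    have "{Z::real^'d. \<forall>k. Z $ k > 0} = (\<Inter>k. {Z. 0 < Z $ k})"
      by auto
    then show ?thesis
      by (auto intro!: open_INT open_Collect_less continuous_intros)
  qed
  have KG: "((\<lambda>Z. K *\<^sub>R G ((\<chi> k. ln (Z $ k)) + b)) has_derivative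
      (\<lambda>v. K *\<^sub>R D (\<chi> k. v $ k / X $ k))) (at X)"
  proof -
    have "((\<lambda>Z. ln (Z $ k)) has_derivative (\<lambda>v. v $ k / X $ k)) (at X)" for k
      using pos[of k] bounded_linear_imp_has_derivative[OF bounded_linear_vec_nth, of k]
      by (auto intro!: derivative_eq_intros simp: divide_inverse)
    then have "((\<lambda>Z. \<chi> k. ln (Z $ k)) has_derivative (\<lambda>v. \<chi> k. v $ k / X $ k)) (at X)"
      by (subst has_derivative_componentwise_within) (auto simp: Basis_vec_def inner_axis)
    then have "((\<lambda>Z. (\<chi> k. ln (Z $ k)) + b) has_derivative (\<lambda>v. \<chi> k. v $ k / X $ k)) (at X)"
      by (auto intro!: derivative_eq_intros)
    then show ?thesis
      using deriv y by (intro has_derivative_scaleR_right has_derivative_compose[of _ _ X UNIV G]) auto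
  qed
  have F: "(F has_derivative (\<lambda>v. K *\<^sub>R D (\<chi> k. v $ k / X $ k))) (at X)"
    using pos by (intro has_derivative_transform_within_open[OF KG open_orthant]) (simp_all add: FG)
  have "inj ((*v) (jacobian F (at X)))"
  proof -
    have "(*v) (jacobian F (at X)) = (\<lambda>v. K *\<^sub>R D (\<chi> k. v $ k / X $ k))"
    proof -
      have "(F has_derivative (\<lambda>v. jacobian F (at X) *v v)) (at X)"
        using differentiableI[OF F] by (simp add: jacobian_works)
      then show ?thesis
        using F by (rule has_derivative_unique)
    qed
    moreover have "inj (\<lambda>v. K *\<^sub>R D (\<chi> k. v $ k / X $ k))"
    proof (rule injI)
      fix u v assume "K *\<^sub>R D (\<chi> k. u $ k / X $ k) = K *\<^sub>R D (\<chi> k. v $ k / X $ k)"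
      then have "D (\<chi> k. u $ k / X $ k) = D (\<chi> k. v $ k / X $ k)"
        using K by simp
      then have quot: "(\<chi> k. u $ k / X $ k) = (\<chi> k. v $ k / X $ k)"
        by (rule injD[OF inj])
      have "u $ k = v $ k" for k
      proof -
        have "u $ k / X $ k = v $ k / X $ k"
          using arg_cong[OF quot, of "\<lambda>z. z $ k"] by simp
        then show ?thesis
          using pos[of k] by simp
      qed
      then show "u = v"
        by (simp add: vec_eq_iff)
    qed
    ultimately show ?thesis by simp
  qed
  then have "invertible (jacobian F (at X))"
    by (simp add: invertible_left_inverse matrix_left_invertible_injective)
  moreover have "F X = 0"
    using FG[OF pos] by (simp only: y zero) simp
  ultimately have "X \<in> nondegenerate_positive_solutions F"
    using pos by (simp add: nondegenerate_positive_solutions_def)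
  then show ?thesis
    by (simp only: X_def)
qed

section \<open>Solutions of the system for small parameters\<close>

lemma vertices_simplex:
  fixes S :: "'a::euclidean_space set"
  assumes "n simplex S"
  shows "\<not> affine_dependent (vertices S)" "int (card (vertices S)) = n + 1" "S = convex hull vertices S"
proof -
  obtain V where V: "\<not> affine_dependent V" "int (card V) = n + 1" "S = convex hull V"
    using assms by (auto simp: simplex_def)
  then have "vertices S = V"
    by (simp add: vertices_def extreme_point_of_convex_hull_affine_independent)
  with V show "\<not> affine_dependent (vertices S)" "int (card (vertices S)) = n + 1" "S = convex hull vertices S"
    by auto
qed

text \<open>The bound locates the solution: in logarithmic coordinates it stays within bounded distance of
  \<open>- ln t *\<^sub>R l\<close>, where \<open>l\<close> is the gradient of the affine function that belongs to the simplex. This is what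
  tells the solutions of different simplices apart.\<close>

lemma solutions_of_decorated_simplex:
  fixes a :: "'n::{finite,linorder} \<Rightarrow> real^'d::{finite,linorder}"
    and C :: "real^'n::{finite,linorder}^'d::{finite,linorder}"
  assumes inj_a: "inj a" and simplex: "int CARD('d) simplex \<tau>" and vert: "vertices \<tau> \<subseteq> range a"
    and dec: "positively_decorates C a \<tau>"
    and on: "\<And>v. v \<in> vertices \<tau> \<Longrightarrow> l \<bullet> v + \<gamma> = \<nu> v"
    and off: "\<And>x. x \<in> range a - vertices \<tau> \<Longrightarrow> l \<bullet> x + \<gamma> < \<nu> x"
  shows "\<exists>M. \<forall>\<^sub>F t in at_right 0. \<exists>X\<in>nondegenerate_positive_solutions (viro_system a \<nu> C t).
           norm ((\<chi> k. ln (X $ k)) + ln t *\<^sub>R l) \<le> M"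
proof -
  define h where "h j = \<nu> (a j) - (l \<bullet> a j + \<gamma>)" for j
  have h: "h j \<ge> 0" for j
    using on[of "a j"] off[of "a j"] by (cases "a j \<in> vertices \<tau>") (auto simp: h_def)
  have I: "{j. h j = 0} = {j. a j \<in> vertices \<tau>}"
    using on off by (fastforce simp: h_def)
  have aI: "a ` {j. h j = 0} = vertices \<tau>"
    using vert unfolding I by auto
  obtain w where w: "\<And>j. j \<in> {j. h j = 0} \<Longrightarrow> w j > (0::real)"
      "(\<Sum>j\<in>{j. h j = 0}. w j *\<^sub>R column j C) = 0"
      "\<And>u. (\<Sum>j\<in>{j. h j = 0}. u j *\<^sub>R column j C) = 0 \<Longrightarrow> \<exists>\<kappa>. \<forall>j\<in>{j. h j = 0}. u j = \<kappa> * w j"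
    using oriented_map_kernel[OF dec[unfolded positively_decorates_def]] by (auto simp: I)
  obtain y0 where y0: "\<forall>\<^sub>F t in at_right 0. \<exists>y\<in>cball y0 1.
      (\<Sum>j\<in>UNIV. (t powr h j * exp (y \<bullet> a j)) *\<^sub>R column j C) = 0 \<and>
      inj (\<lambda>v. \<Sum>j\<in>UNIV. (t powr h j * exp (y \<bullet> a j) * (v \<bullet> a j)) *\<^sub>R column j C)"
  proof (rule zeros_near_face_system[of h a, OF h])
    show "\<not> affine_dependent (a ` {j. h j = 0})" "card (a ` {j. h j = 0}) = Suc DIM(real^'d::{finite,linorder})"
      using vertices_simplex[OF simplex] by (simp_all add: aI)
    show "inj_on a {j. h j = 0}"
      using inj_a by (rule inj_on_subset) simp
  qed (use w in auto)
  have "\<forall>\<^sub>F t in at_right 0. t > (0::real)"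
    by (simp add: eventually_at_right_less)
  with y0 have "\<forall>\<^sub>F t in at_right 0. \<exists>X\<in>nondegenerate_positive_solutions (viro_system a \<nu> C t).
           norm ((\<chi> k. ln (X $ k)) + ln t *\<^sub>R l) \<le> norm y0 + 1"
  proof eventually_elim
    case (elim t)
    then obtain y where y: "y \<in> cball y0 1" "(\<Sum>j\<in>UNIV. (t powr h j * exp (y \<bullet> a j)) *\<^sub>R column j C) = 0"
      "inj (\<lambda>v. \<Sum>j\<in>UNIV. (t powr h j * exp (y \<bullet> a j) * (v \<bullet> a j)) *\<^sub>R column j C)"
      by auto
    define X where "X = (\<chi> k::'d. exp (y $ k - (ln t *\<^sub>R l) $ k))"
    have "X \<in> nondegenerate_positive_solutions (viro_system a \<nu> C t)"
      unfolding X_def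
    proof (rule nondegenerate_zero_log_coordinates[OF _ _ exponential_sum_has_derivative y(2,3)])
      show "viro_system a \<nu> C t Z = t powr \<gamma> *\<^sub>R
        (\<Sum>j\<in>UNIV. (t powr h j * exp (((\<chi> k. ln (Z $ k)) + ln t *\<^sub>R l) \<bullet> a j)) *\<^sub>R column j C)"
        if "\<And>k. Z $ k > 0" for Z
        unfolding h_def by (rule viro_system_log_coordinates[OF that elim(2)])
    qed (use elim in auto)
    moreover have "(\<chi> k. ln (X $ k)) + ln t *\<^sub>R l = y"
      by (simp add: X_def vec_eq_iff)
    moreover have "norm y \<le> norm y0 + 1"
      using y(1) norm_triangle_sub[of y y0] by (simp add: dist_norm norm_minus_commute)
    ultimately show ?case
      by auto
  qed
  then show ?thesis by blast
qed

lemma eventually_separated: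
  fixes l l' :: "'a::real_normed_vector"
  assumes "l \<noteq> l'"
  shows "\<forall>\<^sub>F t in at_right (0::real). M < norm (ln t *\<^sub>R l - ln t *\<^sub>R l')"
proof -
  have pos: "norm (l - l') > 0"
    using assms by simp
  have "\<forall>\<^sub>F t in at_right (0::real). ln t < - \<bar>M / norm (l - l')\<bar>"
    using ln_at_0 unfolding filterlim_at_bot_dense by blast
  then show ?thesis
  proof eventually_elim
    case (elim t)
    then have "M / norm (l - l') < \<bar>ln t\<bar>"
      by linarith
    then have "M < \<bar>ln t\<bar> * norm (l - l')"
      using pos by (simp add: field_simps)
    then show ?case
      by (simp flip: scaleR_diff_right)
  qed
qed

text \<open>For a fixed gradient the constant is forced to be the minimum of \<open>\<nu> - L\<close> over \<open>A\<close>, and the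
  vertex set is the set where this minimum is attained.\<close>

lemma lower_face_determined_by_gradient:
  assumes "\<And>v. v \<in> V \<Longrightarrow> L v + \<gamma> = (\<nu> v :: real)" "\<And>x. x \<in> A - V \<Longrightarrow> L x + \<gamma> < \<nu> x"
    and "\<And>v. v \<in> W \<Longrightarrow> L v + \<gamma>' = \<nu> v" "\<And>x. x \<in> A - W \<Longrightarrow> L x + \<gamma>' < \<nu> x"
    and "V \<subseteq> A" "W \<subseteq> A" "V \<noteq> {}" "W \<noteq> {}"
  shows "V = W"
proof -
  have V: "L x + \<gamma> \<le> \<nu> x" "L x + \<gamma> = \<nu> x \<longleftrightarrow> x \<in> V" if "x \<in> A" for x
    using assms(1)[of x] assms(2)[of x] that by (cases "x \<in> V"; force)+
  have W: "L x + \<gamma>' \<le> \<nu> x" "L x + \<gamma>' = \<nu> x \<longleftrightarrow> x \<in> W" if "x \<in> A" for x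
    using assms(3)[of x] assms(4)[of x] that by (cases "x \<in> W"; force)+
  obtain v w where "v \<in> V" "w \<in> W"
    using assms(7,8) by blast
  then have "\<gamma> = \<gamma>'"
    using assms(1)[of v] W(1)[of v] assms(3)[of w] V(1)[of w] assms(5,6) by force
  then show ?thesis
    using V(2) W(2) assms(5,6) by blast
qed

theorem theorem2p4:
  fixes a :: "'n::{finite,linorder} \<Rightarrow> real^'d::{finite,linorder}"
    and \<nu> :: "real^'d::{finite,linorder} \<Rightarrow> real"
    and \<Gamma> :: "(real^'d::{finite,linorder}) set set"
    and C :: "real^'n::{finite,linorder}^'d::{finite,linorder}"
  assumes "inj a"
    and "aff_dim (convex hull (range a)) = int CARD('d)"
    and "regular_triangulation_with (range a) \<nu> \<Gamma>"
  shows "\<exists>t0>0. \<forall>t. 0 < t \<and> t < t0 \<longrightarrow>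
           {\<tau> \<in> \<Gamma>. int CARD('d) simplex \<tau> \<and> positively_decorates C a \<tau>}
             \<lesssim> nondegenerate_positive_solutions (viro_system a \<nu> C t)"
proof -
  define T where "T = {\<tau> \<in> \<Gamma>. int CARD('d) simplex \<tau> \<and> positively_decorates C a \<tau>}"
  define N where "N t = nondegenerate_positive_solutions (viro_system a \<nu> C t)" for t
  have fin: "finite T"
    using assms(3) unfolding T_def regular_triangulation_with_def triangulation_of_hull_def
      simplicial_complex_def by auto
  have T: "int CARD('d) simplex \<tau>" "vertices \<tau> \<subseteq> range a" "positively_decorates C a \<tau>" if "\<tau> \<in> T" for \<tau>
    using that assms(3) by (auto simp: T_def regular_triangulation_with_def triangulation_of_hull_def)
  have "\<exists>l \<gamma>. (\<forall>v\<in>vertices \<tau>. l \<bullet> v + \<gamma> = \<nu> v) \<and> (\<forall>x\<in>range a - vertices \<tau>. l \<bullet> x + \<gamma> < \<nu> x)"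
    if \<tau>: "\<tau> \<in> T" for \<tau>
  proof -
    obtain L \<gamma> where L: "linear L" "\<forall>v\<in>vertices \<tau>. L v + \<gamma> = \<nu> v"
        "\<forall>x\<in>range a - vertices \<tau>. L x + \<gamma> < \<nu> x"
      using \<tau> assms(3) by (auto simp: T_def regular_triangulation_with_def)
    have "L v = adjoint L 1 \<bullet> v" for v
      using adjoint_works[OF L(1), of v 1] by (simp add: inner_commute)
    with L show ?thesis by metis
  qed
  then obtain l \<gamma> where on: "\<And>\<tau> v. \<tau> \<in> T \<Longrightarrow> v \<in> vertices \<tau> \<Longrightarrow> l \<tau> \<bullet> v + \<gamma> \<tau> = \<nu> v"
    and off: "\<And>\<tau> x. \<tau> \<in> T \<Longrightarrow> x \<in> range a - vertices \<tau> \<Longrightarrow> l \<tau> \<bullet> x + \<gamma> \<tau> < \<nu> x"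
    by metis
  have "\<exists>M. \<forall>\<^sub>F t in at_right 0. \<exists>X\<in>N t. norm ((\<chi> k. ln (X $ k)) + ln t *\<^sub>R l \<tau>) \<le> M"
    if "\<tau> \<in> T" for \<tau>
    unfolding N_def
    by (rule solutions_of_decorated_simplex[OF assms(1) T[OF that] on[OF that] off[OF that]])
  then have "\<forall>\<tau>\<in>T. \<exists>M. \<forall>\<^sub>F t in at_right 0. \<exists>X\<in>N t. norm ((\<chi> k. ln (X $ k)) + ln t *\<^sub>R l \<tau>) \<le> M"
    by blast
  from bchoice[OF this] obtain M where M: "\<And>\<tau>. \<tau> \<in> T \<Longrightarrow>
      \<forall>\<^sub>F t in at_right 0. \<exists>X\<in>N t. norm ((\<chi> k. ln (X $ k)) + ln t *\<^sub>R l \<tau>) \<le> M \<tau>"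
    by blast
  have l_distinct: "l \<sigma> \<noteq> l \<tau>" if \<sigma>: "\<sigma> \<in> T" and \<tau>: "\<tau> \<in> T" and "\<sigma> \<noteq> \<tau>" for \<sigma> \<tau>
  proof
    assume eq: "l \<sigma> = l \<tau>"
    have ne: "vertices \<rho> \<noteq> {}" if "\<rho> \<in> T" for \<rho>
      using vertices_simplex(2)[OF T(1)[OF that]] by auto
    have "vertices \<sigma> = vertices \<tau>"
      by (rule lower_face_determined_by_gradient[where L="\<lambda>v. l \<sigma> \<bullet> v" and A="range a" and \<nu>=\<nu>
            and \<gamma>="\<gamma> \<sigma>" and \<gamma>'="\<gamma> \<tau>"])
        (use on[OF \<sigma>] off[OF \<sigma>] on[OF \<tau>] off[OF \<tau>] T(2)[OF \<sigma>] T(2)[OF \<tau>] ne \<sigma> \<tau> eq in auto)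
    then show False
      using vertices_simplex(3)[OF T(1)[OF \<sigma>]] vertices_simplex(3)[OF T(1)[OF \<tau>]] \<open>\<sigma> \<noteq> \<tau>\<close> by simp
  qed
  have "\<forall>\<^sub>F t in at_right 0. \<forall>\<tau>\<in>T. \<exists>X\<in>N t. norm ((\<chi> k. ln (X $ k)) + ln t *\<^sub>R l \<tau>) \<le> M \<tau>"
    using M fin by (simp add: eventually_ball_finite)
  moreover have "\<forall>\<^sub>F t in at_right 0. \<forall>(\<sigma>, \<tau>)\<in>T \<times> T - Id.
      M \<sigma> + M \<tau> < norm (ln t *\<^sub>R l \<sigma> - ln t *\<^sub>R l \<tau>)"
    using fin l_distinct by (intro eventually_ball_finite) (auto intro!: eventually_separated)
  ultimately have "\<forall>\<^sub>F t in at_right 0. T \<lesssim> N t"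
  proof eventually_elim
    case (elim t)
    then have "\<forall>\<tau>\<in>T. \<exists>X. X \<in> N t \<and> norm ((\<chi> k. ln (X $ k)) + ln t *\<^sub>R l \<tau>) \<le> M \<tau>"
      by blast
    from bchoice[OF this] obtain X where X: "\<And>\<tau>. \<tau> \<in> T \<Longrightarrow> X \<tau> \<in> N t"
        "\<And>\<tau>. \<tau> \<in> T \<Longrightarrow> norm ((\<chi> k. ln (X \<tau> $ k)) + ln t *\<^sub>R l \<tau>) \<le> M \<tau>"
      by blast
    have "inj_on X T"
    proof (rule inj_onI, rule ccontr)
      fix \<sigma> \<tau> assume \<sigma>\<tau>: "\<sigma> \<in> T" "\<tau> \<in> T" "X \<sigma> = X \<tau>" "\<sigma> \<noteq> \<tau>"
      let ?x = "\<chi> k. ln (X \<sigma> $ k)"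
      have "norm (ln t *\<^sub>R l \<sigma> - ln t *\<^sub>R l \<tau>) = norm ((?x + ln t *\<^sub>R l \<sigma>) - (?x + ln t *\<^sub>R l \<tau>))"
        by simp
      also have "\<dots> \<le> M \<sigma> + M \<tau>"
        using X(2)[OF \<sigma>\<tau>(1)] X(2)[OF \<sigma>\<tau>(2)] \<sigma>\<tau>(3) by (intro order_trans[OF norm_triangle_ineq4 add_mono]) auto
      finally show False
        using bspec[OF elim(2), of "(\<sigma>, \<tau>)"] \<sigma>\<tau> by simp
    qed
    with X(1) show ?case
      unfolding lepoll_def by auto
  qed
  then show ?thesis
    unfolding T_def N_def eventually_at_right_field by auto
qed

end
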